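(* Let $\mathcal{N}=\{1,\dots,N\}$ and let $H_P:\mathcal{L}_2^n\rightrightarrows\mathcal{L}_2^n$ be the piecewise linear system $$\begin{cases}\dot x(t)=A_ix(t)+B_iu(t),\\ y(t)=C_ix(t)+D_iu(t),\end{cases}\quad\text{if }\xi(t)\in\mathcal{C}_i,\ i\in\mathcal{N},$$ with $x(0)=0$, $x(t)\in\mathbb{R}^m$, $u(t),y(t)\in\mathbb{R}^n$, $\xi(t)=[x(t)^\top,u(t)^\top]^\top$, and $\mathcal{C}_i=\{\mu\in\mathbb{R}^{m+n}\mid E_i\mu\ge0\}$ with $E_i\in\mathbb{R}^{p\times(m+n)}$. Let $\mathcal{U}\subset\mathcal{L}_2^n$ be the set of inputs considered, subject to the standing assumptions listed in the context. Let $\Pi\in\mathbb{S}^2$ and, for $i\in\mathcal{N}$, $$\Theta_i(\Pi)=\begin{bmatrix} C_i & D_i\\ 0 & I\end{bmatrix}^\top(\Pi\otimes I_n)\begin{bmatrix} C_i & D_i\\ 0 & I\end{bmatrix}.$$ Suppose there exist matrices $U_i\in\mathbb{S}^p_{\ge0}$, $i\in\mathcal{N}$, and a matrix $P\in\mathbb{S}^m$ such that $$\begin{bmatrix} A_i & B_i\\ I & 0\end{bmatrix}^\top\begin{bmatrix}0&P\\P&0\end{bmatrix}\begin{bmatrix} A_i & B_i\\ I & 0\end{bmatrix}-\Theta_i(\Pi)+E_i^\top U_iE_i\preceq0\quad\text{for all }i\in\mathcal{N}.$$ Then $\mathrm{SG}_{\mathcal{U}}(H_P)\subseteq\mathcal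{S}(\Pi)$.
   Context: $\mathbb{S}^k$ is the set of real symmetric $k\times k$ matrices; $\mathbb{S}^k_{\ge0}$ is the set of real symmetric $k\times k$ matrices all of whose entries are nonnegative; $\preceq0$ means negative semidefinite; inequalities such as $E_i\mu\ge0$ are componentwise; $\otimes$ is the Kronecker product. $\mathcal{L}_2^n$ is the space of square-integrable functions $u:\mathbb{R}_{\ge0}\to\mathbb{R}^n$ with $\langle u,y\rangle=\int_0^\infty u(t)^\top y(t)\,dt$ and $\|u\|=\sqrt{\langle u,u\rangle}$. Standing assumptions: $\bigcup_{i\in\mathcal{N}}\mathcal{C}_i=\mathbb{R}^{m+n}$; solutions exist in the sense of Carathéodory, i.e. $x$ is absolutely continuous and satisfies the system equations for almost all times; $u\in\mathcal{U}$ leads to $x,y\in\mathcal{L}_2$, such that $\dot x\in\mathcal{L}_2$. Moreover $H_P(0)=0$. $H_P(u)$ denotes the set of all output trajectories $y$ corresponding to the input $u$. Scaled graph: for $u\neq0$ and $y\in H_P(u)$, put $\rho(u,y)=\|y\|/\|u\|$ and $\theta(u,y)=\arccos\frac{\langle u,y\rangle}{\|u\|\|y\|}\in[0,\pi]$ if $y\ne0$, $\theta(u,y)=0$ if $y=0$. Then $$\mathrm{SG}_{\mathcal{U}}(H_P)=\{\rho(u,y)e^{\pm j\theta(u,y)}\mid u\in\mathcal{U}\setminus\{0\},\ y\in H_P(u)\}\subset\mathbb{C}$$ (both signs are included). For $\Pi\in\mathbb{S}^2$, $\mathcal{S}(\Pi)=\left\{z\in\mathbb{C}\;\middle|\;\begin{bmatrix}z\\1\end{bmatrix}^*\Pi\begin{bmatrix}z\\1\end{bmatrix}\ge0\right\}$,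 where $*$ is conjugate transpose. *)

theory Defs
  imports "HOL-Analysis.Analysis" "HOL-Library.Complex_Order"
begin

subsection \<open>Block matrices, Kronecker product, semidefiniteness\<close>

definition join_vec :: "real ^ 'a \<Rightarrow> real ^ 'b \<Rightarrow> real ^ ('a + 'b)" where
  "join_vec x u = (\<chi> k. case k of Inl a \<Rightarrow> x $ a | Inr b \<Rightarrow> u $ b)"

definition block_row :: "real ^ 'c ^ 'a \<Rightarrow> real ^ 'd ^ 'a \<Rightarrow> real ^ ('c + 'd) ^ 'a" where
  "block_row X Y = (\<chi> r. join_vec (X $ r) (Y $ r))"

definition block_mat ::
  "real ^ 'c ^ 'a \<Rightarrow> real ^ 'd ^ 'a \<Rightarrow> real ^ 'c ^ 'b \<Rightarrow> real ^ 'd ^ 'b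
    \<Rightarrow> real ^ ('c + 'd) ^ ('a + 'b)" where
  "block_mat X Y Z W =
    (\<chi> r. case r of Inl a \<Rightarrow> block_row X Y $ a | Inr b \<Rightarrow> block_row Z W $ b)"

definition kronecker ::
  "real ^ 'b ^ 'a \<Rightarrow> real ^ 'd ^ 'c \<Rightarrow> real ^ ('b \<times> 'd) ^ ('a \<times> 'c)" where
  "kronecker X Y = (\<chi> r s. X $ fst r $ fst s * Y $ snd r $ snd s)"

text \<open>The matrix with the block \<open>X\<close> on top of the block \<open>Y\<close>, where \<open>X\<close> and \<open>Y\<close> have
  equally many rows. Its rows are indexed as those of \<open>kronecker M (mat 1)\<close> for a
  \<open>2 \<times> 2\<close> matrix \<open>M\<close>. The two elements of type \<open>2\<close> are \<open>1\<close> and \<open>2 = 0\<close>, and \<open>1\<close> is the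
  first index.\<close>

definition stack2 :: "real ^ 'c ^ 'n \<Rightarrow> real ^ 'c ^ 'n \<Rightarrow> real ^ 'c ^ (2 \<times> 'n)" where
  "stack2 X Y = (\<chi> r. if fst r = 1 then X $ snd r else Y $ snd r)"

definition symmetric_mat :: "real ^ 'k ^ 'k \<Rightarrow> bool" where
  "symmetric_mat M \<longleftrightarrow> transpose M = M"

definition neg_semidef :: "real ^ 'k ^ 'k \<Rightarrow> bool" where
  "neg_semidef M \<longleftrightarrow> symmetric_mat M \<and> (\<forall>v. v \<bullet> (M *v v) \<le> 0)"

definition symmetric_nonneg_mat :: "real ^ 'k ^ 'k \<Rightarrow> bool" where
  "symmetric_nonneg_mat M \<longleftrightarrow> symmetric_mat M \<and> (\<forall>i j. 0 \<le> M $ i $ j)"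

subsection \<open>Square-integrable signals on the half-line\<close>

text \<open>Signals are represented by functions on \<open>real\<close> of which only the values at times
  \<open>t \<ge> 0\<close> matter; equality of signals is equality almost everywhere on \<open>{0..}\<close>, so the
  zero signal is characterised by \<open>L2_zero\<close>.\<close>

definition L2 :: "(real \<Rightarrow> 'a::euclidean_space) set" where
  "L2 = {u. u \<in> borel_measurable (lebesgue_on {0..}) \<and>
            integrable (lebesgue_on {0..}) (\<lambda>t. (norm (u t))\<^sup>2)}"

definition L2_zero :: "(real \<Rightarrow> 'a::euclidean_space) \<Rightarrow> bool" where
  "L2_zero u \<longleftrightarrow> (AE t in lebesgue_on {0..}. u t = 0)"

definition L2_inner :: "(real \<Rightarrow> 'a::euclidean_space) \<Rightarrow> (real \<Rightarrow> 'a) \<Rightarrow> real" where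
  "L2_inner u y = integral\<^sup>L (lebesgue_on {0..}) (\<lambda>t. u t \<bullet> y t)"

definition L2_norm :: "(real \<Rightarrow> 'a::euclidean_space) \<Rightarrow> real" where
  "L2_norm u = sqrt (L2_inner u u)"

subsection \<open>Piecewise linear systems\<close>

text \<open>Finite families of non-overlapping compact intervals are given as divisions (of their
  union). On the half-line, absolute continuity is required on every compact subinterval.\<close>

definition abs_continuous_on :: "real \<Rightarrow> real \<Rightarrow> (real \<Rightarrow> 'a::real_normed_vector) \<Rightarrow> bool" where
  "abs_continuous_on a b f \<longleftrightarrow>
    (\<forall>\<epsilon>>0. \<exists>\<delta>>0. \<forall>\<D> S. \<D> division_of S \<and> S \<subseteq> {a..b} \<and> (\<Sum>K\<in>\<D>. Sup K - Inf K) < \<delta>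
       \<longrightarrow> (\<Sum>K\<in>\<D>. norm (f (Sup K) - f (Inf K))) < \<epsilon>)"

definition locally_abs_continuous :: "(real \<Rightarrow> 'a::real_normed_vector) \<Rightarrow> bool" where
  "locally_abs_continuous f \<longleftrightarrow> (\<forall>T\<ge>0. abs_continuous_on 0 T f)"

text \<open>In \<open>0 \<le> F *v \<mu>\<close> the order on vectors is the componentwise one.\<close>

definition cell :: "real ^ 'k ^ 'p \<Rightarrow> (real ^ 'k) set" where
  "cell F = {\<mu>. 0 \<le> F *v \<mu>}"

text \<open>Caratheodory trajectories from the initial state \<open>0\<close>. At a point lying in several
  cells (for instance on a common boundary), any one of the corresponding modes may be
  active; it then governs both the state and the output equation.\<close>

definition pwl_trajectory ::
  "nat \<Rightarrow> (nat \<Rightarrow> real ^ 'm ^ 'm) \<Rightarrow> (nat \<Rightarrow> real ^ 'n ^ 'm) \<Rightarrow>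
   (nat \<Rightarrow> real ^ 'm ^ 'n) \<Rightarrow> (nat \<Rightarrow> real ^ 'n ^ 'n) \<Rightarrow>
   (nat \<Rightarrow> real ^ ('m + 'n) ^ 'p) \<Rightarrow>
   (real \<Rightarrow> real ^ 'n) \<Rightarrow> (real \<Rightarrow> real ^ 'm) \<Rightarrow> (real \<Rightarrow> real ^ 'n) \<Rightarrow> bool" where
  "pwl_trajectory N A B C D E u x y \<longleftrightarrow>
     x 0 = 0 \<and> locally_abs_continuous x \<and>
     (AE t in lebesgue_on {0..}. \<exists>i\<in>{1..N}.
        join_vec (x t) (u t) \<in> cell (E i) \<and>
        (x has_vector_derivative (A i *v x t + B i *v u t)) (at t within {0..}) \<and>
        y t = C i *v x t + D i *v u t)"

definition pwl_output ::
  "nat \<Rightarrow> (nat \<Rightarrow> real ^ 'm ^ 'm) \<Rightarrow> (nat \<Rightarrow> real ^ 'n ^ 'm) \<Rightarrow>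
   (nat \<Rightarrow> real ^ 'm ^ 'n) \<Rightarrow> (nat \<Rightarrow> real ^ 'n ^ 'n) \<Rightarrow>
   (nat \<Rightarrow> real ^ ('m + 'n) ^ 'p) \<Rightarrow>
   (real \<Rightarrow> real ^ 'n) \<Rightarrow> (real \<Rightarrow> real ^ 'n) set" where
  "pwl_output N A B C D E u = {y \<in> L2. \<exists>x. pwl_trajectory N A B C D E u x y}"

subsection \<open>Scaled graphs\<close>

definition sg_gain :: "(real \<Rightarrow> real ^ 'n) \<Rightarrow> (real \<Rightarrow> real ^ 'n) \<Rightarrow> real" where
  "sg_gain u y = L2_norm y / L2_norm u"

definition sg_phase :: "(real \<Rightarrow> real ^ 'n) \<Rightarrow> (real \<Rightarrow> real ^ 'n) \<Rightarrow> real" where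
  "sg_phase u y =
     (if L2_zero y then 0 else arccos (L2_inner u y / (L2_norm u * L2_norm y)))"

definition scaled_graph ::
  "(real \<Rightarrow> real ^ 'n) set \<Rightarrow> ((real \<Rightarrow> real ^ 'n) \<Rightarrow> (real \<Rightarrow> real ^ 'n) set) \<Rightarrow> complex set" where
  "scaled_graph \<U> H =
     {z. \<exists>u\<in>\<U>. \<not> L2_zero u \<and> (\<exists>y\<in>H u.
           z = rcis (sg_gain u y) (sg_phase u y) \<or> z = rcis (sg_gain u y) (- sg_phase u y))}"

text \<open>The order on \<open>complex\<close> is the one for which \<open>0 \<le> w\<close> means that \<open>w\<close> is real and
  nonnegative; for symmetric \<open>M\<close> the form below is always real.\<close>

definition multiplier_set :: "real ^ 2 ^ 2 \<Rightarrow> complex set" where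
  "multiplier_set M =
     {z. let v = (vector [z, 1] :: complex ^ 2)
         in 0 \<le> (\<Sum>i\<in>UNIV. \<Sum>j\<in>UNIV. cnj (v $ i) * complex_of_real (M $ i $ j) * v $ j)}"

definition Theta :: "real ^ 'm ^ 'n \<Rightarrow> real ^ 'n ^ 'n \<Rightarrow> real ^ 2 ^ 2 \<Rightarrow> real ^ ('m + 'n) ^ ('m + 'n)" where
  "Theta C D M =
     (let G = stack2 (block_row C D) (block_row 0 (mat 1))
      in transpose G ** kronecker M (mat 1 :: real ^ 'n ^ 'n) ** G)"

end

theory Submission
  imports Defs
begin

text \<open>At almost every time the inequality for the active mode, evaluated at \<open>join_vec x u\<close>,
  bounds the derivative of the storage function \<open>V t = x t \<bullet> (P *v x t)\<close> by the supply rate, the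
  quadratic form of \<open>M\<close> in the output and the input: the term with \<open>U i\<close> is nonnegative on the
  cell. Integrating, \<open>V T\<close> is at most the energy supplied up to time \<open>T\<close>. Since \<open>P\<close> need not be
  definite, nonnegativity of the total energy comes from \<open>x \<in> L2\<close>: were it negative, \<open>V T\<close> and
  hence \<open>- (norm (x T))\<^sup>2\<close> would eventually stay below a negative constant. Dividing the total
  energy by \<open>(L2_norm u)\<^sup>2\<close> gives the quadratic form of \<open>M\<close> at the points of the scaled graph.\<close>

subsection \<open>Absolutely continuous functions\<close>

text \<open>The straddle lemma of gauge integration: as \<open>t\<close> lies between
  \<open>r\<close> and \<open>s\<close>, the one-sided errors \<open>c * (t - r)\<close> and
  \<open>c * (s - t)\<close> add up to \<open>c * (s - r)\<close>. Smallness is expressed by a ball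
  around \<open>t\<close> because fineness of a gauge supplies it in that form.\<close>

lemma vector_derivative_straddle:
  fixes f :: "real \<Rightarrow> 'a::real_normed_vector"
  assumes "(f has_vector_derivative D) (at t within S)" "c > 0"
  obtains \<eta> where "\<eta> > 0"
    "\<And>r s. r \<in> S \<Longrightarrow> s \<in> S \<Longrightarrow> r \<le> t \<Longrightarrow> t \<le> s \<Longrightarrow> {r..s} \<subseteq> ball t \<eta> \<Longrightarrow>
      norm ((s - r) *\<^sub>R D - (f s - f r)) \<le> c * (s - r)"
proof -
  obtain \<eta> where \<eta>: "\<eta> > 0" "\<And>q. q \<in> S \<Longrightarrow> norm (q - t) < \<eta> \<Longrightarrow>
      norm (f q - f t - (q - t) *\<^sub>R D) \<le> c * norm (q - t)"
    using assms unfolding has_vector_derivative_def has_derivative_within_alt by metis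
  have "norm ((s - r) *\<^sub>R D - (f s - f r)) \<le> c * (s - r)"
    if "r \<in> S" "s \<in> S" "r \<le> t" "t \<le> s" "{r..s} \<subseteq> ball t \<eta>" for r s
  proof -
    have "r \<in> ball t \<eta>" "s \<in> ball t \<eta>"
      using that(3-) subsetD[OF that(5), of r] subsetD[OF that(5), of s] by auto
    then have "norm (f r - f t - (r - t) *\<^sub>R D) \<le> c * (t - r)"
      "norm (f s - f t - (s - t) *\<^sub>R D) \<le> c * (s - t)"
      using \<eta>(2)[of r] \<eta>(2)[of s] that by (auto simp: dist_norm)
    moreover have "(s - r) *\<^sub>R D - (f s - f r)
        = (f r - f t - (r - t) *\<^sub>R D) - (f s - f t - (s - t) *\<^sub>R D)"
      by (simp add: algebra_simps)
    ultimately show ?thesis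
      using norm_triangle_ineq4[of "f r - f t - (r - t) *\<^sub>R D" "f s - f t - (s - t) *\<^sub>R D"]
      by (simp add: algebra_simps)
  qed
  with \<eta>(1) that show thesis by blast
qed

text \<open>Outer regularity bounds the measure of \<open>W - S\<close>, and a null set does not
  change the measure of \<open>W\<close>. The set serves as the gauge at exceptional tags: their
  intervals then have total length below the threshold of absolute continuity.\<close>

lemma negligible_outer_open:
  assumes "negligible S" "\<delta> > 0"
  obtains W where "open W" "S \<subseteq> W" "W \<in> lmeasurable" "measure lebesgue W < \<delta>"
proof -
  have S: "S \<in> null_sets lebesgue"
    using assms(1) by (simp add: negligible_iff_null_sets)
  obtain W where W: "open W" "S \<subseteq> W" "W - S \<in> lmeasurable" "emeasure lebesgue (W - S) < ennreal \<delta>"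
    using sets_lebesgue_outer_open[OF null_setsD2[OF S] assms(2)] .
  have "W \<in> lmeasurable"
    using W S by (metis borel_open measurable_Diff_null_set sets_completionI_sets sets_lborel)
  moreover have "measure lebesgue W = measure lebesgue (W - S)"
    using W(1) S by (simp add: measure_Diff_null_set)
  moreover have "measure lebesgue (W - S) < \<delta>"
    using W(3,4) assms(2) by (simp add: emeasure_eq_measure2 ennreal_less_iff)
  ultimately show thesis using W that by simp
qed

text \<open>In a sufficiently fine Riemann sum, tags in the exceptional set contribute little by
  absolute continuity, and all others by differentiability.\<close>

lemma abs_continuous_on_has_integral:
  fixes f :: "real \<Rightarrow> 'a::euclidean_space"
  assumes ab: "a \<le> b" and ac: "abs_continuous_on a b f" and neg: "negligible S"
    and deriv: "\<And>t. t \<in> {a..b} - S \<Longrightarrow> (f has_vector_derivative f' t) (at t within {a..b})"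
  shows "(f' has_integral f b - f a) {a..b}"
proof -
  \<comment> \<open>Setting the integrand to zero on the null set leaves only the increment of
    \<open>f\<close> in a Riemann term tagged there.\<close>
  define g where "g t = (if t \<in> S then 0 else f' t)" for t
  have "(g has_integral f b - f a) {a..b}"
    unfolding has_integral_real
  proof (intro allI impI)
    fix e :: real assume e: "e > 0"
    obtain \<delta> where \<delta>: "\<delta> > 0" and ac': "\<And>\<D> S. \<D> division_of S \<Longrightarrow> S \<subseteq> {a..b} \<Longrightarrow>
        (\<Sum>K\<in>\<D>. Sup K - Inf K) < \<delta> \<Longrightarrow> (\<Sum>K\<in>\<D>. norm (f (Sup K) - f (Inf K))) < e / 2"
      using ac e unfolding abs_continuous_on_def by (meson half_gt_zero)
    obtain W where W: "open W" "S \<subseteq> W" "W \<in> lmeasurable" "measure lebesgue W < \<delta>"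
      using negligible_outer_open[OF neg \<delta>] .
    \<comment> \<open>The summand 1 makes \<open>c * (b - a) < e / 2\<close> strict and keeps the
      quotient meaningful when \<open>a = b\<close>.\<close>
    define c where "c = e / (2 * (b - a + 1))"
    have c: "c > 0" "c * (b - a) < e / 2"
      using e ab by (auto simp: c_def field_simps)
    have "\<exists>\<eta>>0. \<forall>r s. r \<in> {a..b} \<longrightarrow> s \<in> {a..b} \<longrightarrow> r \<le> t \<longrightarrow> t \<le> s \<longrightarrow> {r..s} \<subseteq> ball t \<eta> \<longrightarrow>
        norm ((s - r) *\<^sub>R f' t - (f s - f r)) \<le> c * (s - r)"
      if "t \<in> {a..b} - S" for t
      using vector_derivative_straddle[OF deriv[OF that] c(1)] by metis
    then obtain \<eta> where \<eta>: "\<And>t. t \<in> {a..b} - S \<Longrightarrow> \<eta> t > 0"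
      "\<And>t r s. t \<in> {a..b} - S \<Longrightarrow> r \<in> {a..b} \<Longrightarrow> s \<in> {a..b} \<Longrightarrow> r \<le> t \<Longrightarrow> t \<le> s \<Longrightarrow>
         {r..s} \<subseteq> ball t (\<eta> t) \<Longrightarrow> norm ((s - r) *\<^sub>R f' t - (f s - f r)) \<le> c * (s - r)"
      by metis
    define \<gamma> where "\<gamma> t = (if t \<in> S then W else if t \<in> {a..b} then ball t (\<eta> t) else UNIV)" for t
    have "gauge \<gamma>"
      unfolding gauge_def \<gamma>_def using W \<eta>(1) by auto
    moreover have "norm ((\<Sum>(t, K)\<in>p. measure lborel K *\<^sub>R g t) - (f b - f a)) < e"
      if p: "p tagged_division_of {a..b}" and fine: "\<gamma> fine p" for p
    proof -
      define q where "q = {z \<in> p. fst z \<in> S}"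
      note pD = tagged_division_ofD[OF p]
      have fin: "finite p" "finite q" and qp: "q \<subseteq> p"
        using pD(1) by (auto simp: q_def)
      have interval: "\<exists>r s. K = {r..s} \<and> r \<le> t \<and> t \<le> s \<and> r \<in> {a..b} \<and> s \<in> {a..b}
          \<and> Sup K = s \<and> Inf K = r \<and> measure lborel K = s - r" if tK: "(t, K) \<in> p" for t K
      proof -
        obtain r s where "K = {r..s}" using pD(4)[OF tK] by auto
        moreover have "t \<in> K" "K \<subseteq> {a..b}" using pD(2,3)[OF tK] by auto
        ultimately show ?thesis by (intro exI[of _ r] exI[of _ s]) auto
      qed
      define h where "h = (\<lambda>(t, K). measure lborel K *\<^sub>R g t - (f (Sup K) - f (Inf K)))"
      have "(\<Sum>(t, K)\<in>p. measure lborel K *\<^sub>R g t) - (f b - f a) = sum h p"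
        unfolding h_def additive_tagged_division_1[OF ab p, symmetric]
        by (simp add: sum_subtractf[symmetric] split_def)
      also have "\<dots> = sum h (p - q) + sum h q"
        using sum.subset_diff[OF qp fin(1)] by simp
      finally have eq: "(\<Sum>(t, K)\<in>p. measure lborel K *\<^sub>R g t) - (f b - f a) = sum h (p - q) + sum h q" .
      have "norm (sum h (p - q)) \<le> (\<Sum>(t, K)\<in>p - q. c * measure lborel K)"
      proof (rule sum_norm_le, clarsimp simp: h_def)
        fix t K assume tK: "(t, K) \<in> p" "(t, K) \<notin> q"
        then have t: "t \<in> {a..b} - S"
          using pD(2,3)[OF tK(1)] by (auto simp: q_def)
        then have "K \<subseteq> ball t (\<eta> t)"
          using fineD[OF fine tK(1)] by (auto simp: \<gamma>_def)
        then show "norm (measure lborel K *\<^sub>R g t - (f (Sup K) - f (Inf K))) \<le> c * measure lborel K"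
          using interval[OF tK(1)] \<eta>(2)[OF t] t by (auto simp: g_def)
      qed
      also have "\<dots> \<le> (\<Sum>(t, K)\<in>p. c * measure lborel K)"
        using fin c by (intro sum_mono2) auto
      also have "\<dots> = c * (b - a)"
        using additive_content_tagged_division[of p a b] p ab
        by (simp add: sum_distrib_left[symmetric] split_def)
      finally have 1: "norm (sum h (p - q)) \<le> c * (b - a)" .

      have "p tagged_partial_division_of {a..b}"
        using p by (simp add: tagged_division_of_def)
      then have q: "q tagged_division_of \<Union>(snd ` q)"
        using tagged_partial_division_of_Union_self tagged_partial_division_subset[OF _ qp] by blast
      then have div: "snd ` q division_of \<Union>(snd ` q)"
        by (rule division_of_tagged_division)
      have "\<Union>(snd ` q) \<subseteq> W"
        using fineD[OF fine] by (fastforce simp: q_def \<gamma>_def)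
      have "(\<Sum>K\<in>snd ` q. Sup K - Inf K) = (\<Sum>K\<in>snd ` q. measure lebesgue K)"
      proof (rule sum.cong)
        fix K assume "K \<in> snd ` q"
        then obtain t where "(t, K) \<in> p"
          using qp by auto
        then obtain r s where "K = {r..s}" "r \<le> s"
          using interval[of t K] order_trans by blast
        then show "Sup K - Inf K = measure lebesgue K"
          by simp
      qed simp
      also have "\<dots> = measure lebesgue (\<Union>(snd ` q))"
        using content_division[OF div] .
      also have "\<dots> \<le> measure lebesgue W"
        using \<open>\<Union>(snd ` q) \<subseteq> W\<close> W div lmeasurable_division
        by (intro measure_mono_fmeasurable fmeasurableD) auto
      finally have small: "(\<Sum>K\<in>snd ` q. Sup K - Inf K) < \<delta>"
        using W by simp
      \<comment> \<open>The empty set is excluded because \<open>Sup {}\<close> and \<open>Inf {}\<close> are unspecified reals.\<close>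
      define \<Delta> where "\<Delta> K = (if K = {} then 0 else norm (f (Sup K) - f (Inf K)))" for K
      have nonempty: "K \<noteq> {}" if "K \<in> snd ` q" for K
        using pD(2) qp that by fastforce
      have "norm (sum h q) \<le> (\<Sum>(t, K)\<in>q. norm (f (Sup K) - f (Inf K)))"
        by (rule sum_norm_le) (auto simp: h_def q_def g_def norm_minus_commute)
      also have "\<dots> = (\<Sum>(t, K)\<in>q. \<Delta> K)"
        using nonempty by (intro sum.cong) (force simp: \<Delta>_def)+
      \<comment> \<open>Distinct tags can share an interval only if its interior is empty, and on
        such intervals \<open>\<Delta>\<close> vanishes. The sum thus passes from tagged intervals
        to bare ones, to which absolute continuity applies.\<close>
      also have "\<dots> = (\<Sum>K\<in>snd ` q. \<Delta> K)"
        using q by (rule sum.over_tagged_division_lemma) (auto simp: \<Delta>_def)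
      also have "\<dots> = (\<Sum>K\<in>snd ` q. norm (f (Sup K) - f (Inf K)))"
        using nonempty by (intro sum.cong) (auto simp: \<Delta>_def)
      also have "\<dots> < e / 2"
        using div small pD(3) qp by (intro ac') fastforce+
      finally have "norm (sum h q) < e / 2" .
      then show ?thesis
        unfolding eq using 1 c norm_triangle_ineq[of "sum h (p - q)" "sum h q"] by linarith
    qed
    ultimately show "\<exists>\<gamma>. gauge \<gamma> \<and> (\<forall>\<D>. \<D> tagged_division_of {a..b} \<and> \<gamma> fine \<D> \<longrightarrow>
        norm ((\<Sum>(x, k)\<in>\<D>. measure lborel k *\<^sub>R g x) - (f b - f a)) < e)"
      by (intro exI[of _ \<gamma>]) simp
  qed
  then show ?thesis
    by (rule has_integral_spike[OF neg, rotated]) (auto simp: g_def)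
qed

text \<open>Divisions consisting of a single interval already give continuity.\<close>

lemma abs_continuous_on_imp_continuous_on:
  fixes f :: "real \<Rightarrow> 'a::real_normed_vector"
  assumes "abs_continuous_on a b f"
  shows "continuous_on {a..b} f"
proof -
  have step: "\<exists>\<delta>>0. \<forall>r s. a \<le> r \<longrightarrow> r \<le> s \<longrightarrow> s \<le> b \<longrightarrow> s - r < \<delta> \<longrightarrow> norm (f s - f r) < e"
    if e: "e > 0" for e
  proof -
    obtain \<delta> where "\<delta> > 0" and \<delta>: "\<And>\<D> S. \<D> division_of S \<Longrightarrow> S \<subseteq> {a..b} \<Longrightarrow>
        (\<Sum>K\<in>\<D>. Sup K - Inf K) < \<delta> \<Longrightarrow> (\<Sum>K\<in>\<D>. norm (f (Sup K) - f (Inf K))) < e"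
      using assms e unfolding abs_continuous_on_def by meson
    have "norm (f s - f r) < e" if "a \<le> r" "r \<le> s" "s \<le> b" "s - r < \<delta>" for r s
      using \<delta>[of "{{r..s}}" "{r..s}"] that division_of_self[of r s] by simp
    with \<open>\<delta> > 0\<close> show ?thesis by blast
  qed
  show ?thesis
    unfolding continuous_on_iff
  proof (intro ballI allI impI)
    fix t e assume "t \<in> {a..b}" "(e::real) > 0"
    then obtain \<delta> where "\<delta> > 0"
      and \<delta>: "\<And>r s. a \<le> r \<Longrightarrow> r \<le> s \<Longrightarrow> s \<le> b \<Longrightarrow> s - r < \<delta> \<Longrightarrow> norm (f s - f r) < e"
      using step by metis
    have "dist (f s) (f t) < e" if "s \<in> {a..b}" "dist s t < \<delta>" for s
    proof (cases "s \<le> t")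
      case True
      then show ?thesis
        using \<delta>[of s t] that \<open>t \<in> {a..b}\<close> by (simp add: dist_norm norm_minus_commute)
    next
      case False
      then show ?thesis
        using \<delta>[of t s] that \<open>t \<in> {a..b}\<close> by (simp add: dist_norm)
    qed
    with \<open>\<delta> > 0\<close> show "\<exists>d>0. \<forall>s\<in>{a..b}. dist s t < d \<longrightarrow> dist (f s) (f t) < e"
      by blast
  qed
qed

text \<open>Carries absolute continuity from the state to the storage function, which is Lipschitz
  in the state on bounded sets. Increments between points of \<open>{a..b}\<close> suffice, since
  the definition sees only endpoints of the intervals.\<close>

lemma abs_continuous_on_lipschitz_image:
  fixes f :: "real \<Rightarrow> 'a::real_normed_vector" and g :: "real \<Rightarrow> 'b::real_normed_vector"
  assumes f: "abs_continuous_on a b f"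
    and L: "\<And>r s. r \<in> {a..b} \<Longrightarrow> s \<in> {a..b} \<Longrightarrow> norm (g s - g r) \<le> L * norm (f s - f r)"
  shows "abs_continuous_on a b g"
  unfolding abs_continuous_on_def
proof (intro allI impI)
  fix e :: real assume e: "e > 0"
  \<comment> \<open>\<open>L\<close> may be zero or negative, whereas the tolerance has to be
    divided by a positive number.\<close>
  define L' where "L' = max L 1"
  have L': "L' > 0" by (simp add: L'_def)
  then have e': "e / L' > 0" using e by simp
  obtain \<delta> where "\<delta> > 0" and \<delta>: "\<And>\<D> S. \<D> division_of S \<Longrightarrow> S \<subseteq> {a..b} \<Longrightarrow>
      (\<Sum>K\<in>\<D>. Sup K - Inf K) < \<delta> \<Longrightarrow> (\<Sum>K\<in>\<D>. norm (f (Sup K) - f (Inf K))) < e / L'"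
    using f[unfolded abs_continuous_on_def, rule_format, OF e'] by metis
  have "(\<Sum>K\<in>\<D>. norm (g (Sup K) - g (Inf K))) < e"
    if D: "\<D> division_of S" "S \<subseteq> {a..b}" "(\<Sum>K\<in>\<D>. Sup K - Inf K) < \<delta>" for \<D> S
  proof -
    have "norm (g (Sup K) - g (Inf K)) \<le> L' * norm (f (Sup K) - f (Inf K))" if K: "K \<in> \<D>" for K
    proof -
      obtain r s where "K = {r..s}" using division_ofD(4)[OF D(1) K] by auto
      moreover have "K \<noteq> {}" "K \<subseteq> {a..b}"
        using division_ofD(2,3)[OF D(1) K] D(2) by auto
      ultimately have "norm (g (Sup K) - g (Inf K)) \<le> L * norm (f (Sup K) - f (Inf K))"
        by (intro L) auto
      also have "\<dots> \<le> L' * norm (f (Sup K) - f (Inf K))"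
        by (intro mult_right_mono) (auto simp: L'_def)
      finally show ?thesis .
    qed
    then have "(\<Sum>K\<in>\<D>. norm (g (Sup K) - g (Inf K)))
        \<le> L' * (\<Sum>K\<in>\<D>. norm (f (Sup K) - f (Inf K)))"
      unfolding sum_distrib_left by (rule sum_mono)
    also have "\<dots> < e"
      using \<delta>[OF D] L' by (simp add: field_simps)
    finally show ?thesis .
  qed
  with \<open>\<delta> > 0\<close> show "\<exists>\<delta>>0. \<forall>\<D> S. \<D> division_of S \<and> S \<subseteq> {a..b} \<and>
      (\<Sum>K\<in>\<D>. Sup K - Inf K) < \<delta> \<longrightarrow> (\<Sum>K\<in>\<D>. norm (g (Sup K) - g (Inf K))) < e"
    by (intro exI[of _ \<delta>] conjI allI impI) auto
qed

subsection \<open>Quadratic forms of block matrices\<close>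

lemma inner_congruence_matrix:
  fixes G :: "real ^ 'b ^ 'a" and K :: "real ^ 'a ^ 'a"
  shows "v \<bullet> ((transpose G ** K ** G) *v v) = (G *v v) \<bullet> (K *v (G *v v))"
proof -
  have "v \<bullet> (transpose G *v w) = (G *v v) \<bullet> w" for w
    by (metis dot_lmul_matrix vector_transpose_matrix)
  then show ?thesis
    by (simp flip: matrix_vector_mul_assoc)
qed

lemma symmetric_mat_nth: "symmetric_mat K \<Longrightarrow> K $ i $ j = K $ j $ i"
  unfolding symmetric_mat_def by (drule arg_cong[of _ _ "\<lambda>K. K $ i $ j"]) (simp add: transpose_def)

lemma symmetric_mat_inner:
  assumes "symmetric_mat K"
  shows "v \<bullet> (K *v w) = w \<bullet> (K *v v)"
  using assms unfolding symmetric_mat_def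
  by (metis dot_lmul_matrix inner_commute vector_transpose_matrix)

lemma sum_UNIV_Plus:
  fixes f :: "'a::finite + 'b::finite \<Rightarrow> 'c::comm_monoid_add"
  shows "sum f UNIV = (\<Sum>a\<in>UNIV. f (Inl a)) + (\<Sum>b\<in>UNIV. f (Inr b))"
  unfolding UNIV_Plus_UNIV[symmetric] by (subst sum.Plus) (auto simp: comp_def)

lemma inner_join_vec: "join_vec x u \<bullet> join_vec x' u' = x \<bullet> x' + u \<bullet> u'"
  by (simp add: inner_vec_def join_vec_def sum_UNIV_Plus)

lemma block_row_mult_join_vec: "block_row X Y *v join_vec x u = X *v x + Y *v u"
  by (simp add: vec_eq_iff matrix_vector_mult_def block_row_def join_vec_def sum_UNIV_Plus)

lemma block_mat_mult_join_vec:
  "block_mat X Y Z W *v join_vec x u = join_vec (X *v x + Y *v u) (Z *v x + W *v u)"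
  by (simp add: vec_eq_iff matrix_vector_mult_def block_mat_def block_row_def join_vec_def
      sum_UNIV_Plus split: sum.split)

text \<open>For symmetric \<open>M\<close> this is the quadratic form at the pair with
  \<open>y\<close> first and \<open>u\<close> second, the two off-diagonal terms being merged;
  \<open>y\<close> and \<open>u\<close> take the places of \<open>z\<close> and 1 in
  \<open>multiplier_set\<close>.\<close>

definition supply_rate :: "real ^ 2 ^ 2 \<Rightarrow> real ^ 'n \<Rightarrow> real ^ 'n \<Rightarrow> real" where
  "supply_rate M u y = M $ 1 $ 1 * (y \<bullet> y) + 2 * (M $ 1 $ 2 * (u \<bullet> y)) + M $ 2 $ 2 * (u \<bullet> u)"

text \<open>The identity factor keeps the components apart: the form is the sum over
  \<open>i\<close> of the forms of \<open>M\<close> at the pairs \<open>y $ i\<close>,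
  \<open>u $ i\<close>.\<close>

lemma kronecker_mat_1_form:
  fixes y u :: "real ^ 'n"
  assumes "symmetric_mat M"
  defines "w \<equiv> \<chi> r. if fst r = 1 then y $ snd r else u $ snd r"
  shows "w \<bullet> (kronecker M (mat 1 :: real ^ 'n ^ 'n) *v w) = supply_rate M u y"
proof -
  have M21: "M $ 2 $ 1 = M $ 1 $ 2"
    using symmetric_mat_nth[OF assms(1)] .
  have pairs: "sum h UNIV = (\<Sum>i\<in>UNIV. h (1, i)) + (\<Sum>i\<in>UNIV. h (2, i))"
    for h :: "2 \<times> 'n \<Rightarrow> real"
    using sum.cartesian_product[of "\<lambda>a b. h (a, b)" UNIV UNIV] by (simp add: sum_2)
  have diag: "(\<Sum>j\<in>UNIV. c * (mat 1 :: real ^ 'n ^ 'n) $ i $ j * z $ j) = c * z $ i" for c i z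
    using matrix_vector_mul_lid[of z, THEN arg_cong, of "\<lambda>z. c * z $ i"]
    by (simp only: matrix_vector_mult_def vec_lambda_beta sum_distrib_left mult.assoc)
  have "kronecker M (mat 1 :: real ^ 'n ^ 'n) *v w =
      (\<chi> r. M $ fst r $ 1 * y $ snd r + M $ fst r $ 2 * u $ snd r)"
    by (simp add: vec_eq_iff matrix_vector_mult_def kronecker_def w_def pairs diag)
  then show ?thesis
    by (simp add: w_def inner_vec_def pairs supply_rate_def M21 sum_distrib_left algebra_simps
        flip: sum.distrib)
qed

lemma stack2_mult:
  "stack2 X Y *v v = (\<chi> r. if fst r = 1 then (X *v v) $ snd r else (Y *v v) $ snd r)"
  by (simp add: vec_eq_iff stack2_def matrix_vector_mult_def)

lemma Theta_form:
  assumes "symmetric_mat M"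
  shows "join_vec x u \<bullet> (Theta C D M *v join_vec x u) = supply_rate M u (C *v x + D *v u)"
  by (simp add: Theta_def Let_def inner_congruence_matrix stack2_mult block_row_mult_join_vec
      kronecker_mat_1_form[OF assms])

text \<open>Entrywise signs do the work here, not semidefiniteness: every term of the double sum is
  a product of nonnegative numbers.\<close>

lemma symmetric_nonneg_mat_form_nonneg:
  assumes "symmetric_nonneg_mat U" "0 \<le> v"
  shows "0 \<le> v \<bullet> (U *v v)"
  using assms
  by (auto simp: symmetric_nonneg_mat_def inner_vec_def matrix_vector_mult_def less_eq_vec_def
      intro!: sum_nonneg mult_nonneg_nonneg)

text \<open>An S-procedure: the term with \<open>U\<close> is nonnegative on the cell, so the
  inequality at \<open>join_vec x u\<close> survives its removal. The outer factor of the first term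
  produces the pair of state derivative and state, on which the off-diagonal \<open>P\<close> gives
  the derivative of the storage function.\<close>

lemma lmi_imp_dissipation:
  assumes "symmetric_mat M" "symmetric_mat P" "symmetric_nonneg_mat U"
    and lmi: "neg_semidef
          (transpose (block_mat A B (mat 1) 0) ** block_mat 0 P P 0 ** block_mat A B (mat 1) 0
             - Theta C D M + transpose E ** U ** E)"
    and cell: "join_vec x u \<in> cell E"
  shows "2 * ((A *v x + B *v u) \<bullet> (P *v x)) \<le> supply_rate M u (C *v x + D *v u)"
proof -
  define v where "v = join_vec x u"
  have "0 \<le> (E *v v) \<bullet> (U *v (E *v v))"
    using cell assms(3) by (simp add: v_def cell_def symmetric_nonneg_mat_form_nonneg)
  moreover have "v \<bullet> ((transpose (block_mat A B (mat 1) 0) ** block_mat 0 P P 0 **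
      block_mat A B (mat 1) 0) *v v) = 2 * ((A *v x + B *v u) \<bullet> (P *v x))"
    unfolding inner_congruence_matrix v_def
    using symmetric_mat_inner[OF assms(2), of x "A *v x + B *v u"]
    by (simp add: block_mat_mult_join_vec inner_join_vec)
  moreover have "v \<bullet> (Theta C D M *v v) = supply_rate M u (C *v x + D *v u)"
    unfolding v_def by (rule Theta_form[OF assms(1)])
  moreover have "v \<bullet> ((transpose (block_mat A B (mat 1) 0) ** block_mat 0 P P 0 **
      block_mat A B (mat 1) 0 - Theta C D M + transpose E ** U ** E) *v v) \<le> 0"
    using lmi unfolding neg_semidef_def by blast
  ultimately show ?thesis
    by (simp add: matrix_vector_mult_add_rdistrib matrix_vector_mult_diff_rdistrib
        inner_add_right inner_diff_right inner_congruence_matrix)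
qed

text \<open>By symmetry the two off-diagonal terms are complex conjugates of each other, so the sum
  is real and they contribute twice a real part.\<close>

lemma multiplier_set_iff:
  assumes "symmetric_mat M"
  shows "z \<in> multiplier_set M \<longleftrightarrow> 0 \<le> M $ 1 $ 1 * (norm z)\<^sup>2 + 2 * (M $ 1 $ 2 * Re z) + M $ 2 $ 2"
proof -
  have M21: "M $ 2 $ 1 = M $ 1 $ 2"
    using symmetric_mat_nth[OF assms] .
  have "(\<Sum>i\<in>UNIV. \<Sum>j\<in>UNIV. cnj ((vector [z, 1] :: complex ^ 2) $ i)
      * complex_of_real (M $ i $ j) * (vector [z, 1] :: complex ^ 2) $ j)
    = complex_of_real (M $ 1 $ 1 * (norm z)\<^sup>2 + 2 * (M $ 1 $ 2 * Re z) + M $ 2 $ 2)"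
    unfolding cmod_power2 by (simp add: sum_2 M21 complex_eq_iff algebra_simps power2_eq_square)
  then show ?thesis
    unfolding multiplier_set_def Let_def mem_Collect_eq by (simp only: less_eq_complex_def) simp
qed

subsection \<open>Square-integrable signals and the scaled graph\<close>

lemma integrable_inner_L2:
  fixes f g :: "real \<Rightarrow> 'a::euclidean_space"
  assumes "f \<in> L2" "g \<in> L2"
  shows "integrable (lebesgue_on {0..}) (\<lambda>t. f t \<bullet> g t)"
proof (rule Bochner_Integration.integrable_bound)
  show "integrable (lebesgue_on {0..}) (\<lambda>t. (norm (f t))\<^sup>2 + (norm (g t))\<^sup>2)"
    using assms by (simp add: L2_def)
  show "(\<lambda>t. f t \<bullet> g t) \<in> borel_measurable (lebesgue_on {0..})"
    using assms by (auto simp: L2_def)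
  have "norm (f t \<bullet> g t) \<le> norm ((norm (f t))\<^sup>2 + (norm (g t))\<^sup>2)" for t
  proof -
    have "\<bar>f t \<bullet> g t\<bar> \<le> norm (f t) * norm (g t)"
      by (rule Cauchy_Schwarz_ineq2)
    also have "\<dots> \<le> (norm (f t))\<^sup>2 + (norm (g t))\<^sup>2"
      using sum_squares_bound[of "norm (f t)" "norm (g t)"]
        mult_nonneg_nonneg[OF norm_ge_zero norm_ge_zero, of "f t" "g t"] by linarith
    finally show ?thesis by simp
  qed
  then show "AE t in lebesgue_on {0..}. norm (f t \<bullet> g t) \<le> norm ((norm (f t))\<^sup>2 + (norm (g t))\<^sup>2)"
    by simp
qed

lemma L2_norm_power2: "(L2_norm f)\<^sup>2 = L2_inner f f"
  by (simp add: L2_norm_def L2_inner_def)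

lemma L2_norm_eq_0_iff:
  assumes "f \<in> L2"
  shows "L2_norm f = 0 \<longleftrightarrow> L2_zero f"
  using integral_nonneg_eq_0_iff_AE[OF integrable_inner_L2[OF assms assms]]
  by (simp add: L2_norm_def L2_inner_def L2_zero_def)

lemma L2_zero_inner: "L2_zero g \<Longrightarrow> L2_inner f g = 0"
  unfolding L2_inner_def L2_zero_def
  by (rule integral_eq_zero_AE) (auto elim: eventually_mono)

text \<open>Puts the argument of \<open>arccos\<close> in \<open>sg_phase\<close> into its domain.
  Signals are functions rather than classes, so \<open>L2_inner\<close> is only semidefinite and a
  \<open>g\<close> that vanishes almost everywhere is a case of its own.\<close>

lemma L2_Cauchy_Schwarz:
  assumes f: "f \<in> L2" and g: "g \<in> L2"
  shows "\<bar>L2_inner f g\<bar> \<le> L2_norm f * L2_norm g"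
proof -
  note [simp] = integrable_inner_L2[OF f f] integrable_inner_L2[OF f g] integrable_inner_L2[OF g g]
  \<comment> \<open>The squared norm of \<open>f + s *\<^sub>R g\<close> as a quadratic in
    \<open>s\<close>; its value at the minimiser gives the claim when \<open>g\<close> is not
    zero.\<close>
  have quad: "0 \<le> L2_inner g g * s\<^sup>2 + 2 * L2_inner f g * s + L2_inner f f" for s
  proof -
    have "0 \<le> (LINT t|lebesgue_on {0..}. (f t + s *\<^sub>R g t) \<bullet> (f t + s *\<^sub>R g t))"
      by simp
    also have "\<dots> = (LINT t|lebesgue_on {0..}. (g t \<bullet> g t) * s\<^sup>2 + 2 * (f t \<bullet> g t) * s + f t \<bullet> f t)"
      by (simp add: inner_commute algebra_simps power2_eq_square)
    also have "\<dots> = L2_inner g g * s\<^sup>2 + 2 * L2_inner f g * s + L2_inner f f"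
      by (simp add: L2_inner_def)
    finally show ?thesis .
  qed
  have "(L2_inner f g)\<^sup>2 \<le> L2_inner f f * L2_inner g g"
  proof (cases "L2_zero g")
    case True
    then show ?thesis by (simp add: L2_zero_inner)
  next
    case False
    then have "L2_inner g g > 0"
      using L2_norm_eq_0_iff[OF g] by (simp add: L2_norm_def L2_inner_def less_le)
    then show ?thesis
      using quad[of "- L2_inner f g / L2_inner g g"] by (simp add: field_simps power2_eq_square)
  qed
  then have "(L2_inner f g)\<^sup>2 \<le> (L2_norm f * L2_norm g)\<^sup>2"
    by (simp add: power_mult_distrib L2_norm_power2)
  then show ?thesis
    by (simp add: abs_le_square_iff[symmetric] L2_norm_def L2_inner_def)
qed

text \<open>Gain and phase determine the inner products of \<open>u\<close> and \<open>y\<close> up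
  to the common factor \<open>(L2_norm u)\<^sup>2\<close>, so the condition on \<open>z\<close> is a
  condition on the total supplied energy.\<close>

lemma scaled_graph_subset_multiplier_set:
  assumes M: "symmetric_mat M" and \<U>: "\<U> \<subseteq> L2" and H: "\<And>u. u \<in> \<U> \<Longrightarrow> H u \<subseteq> L2"
    and dissipative: "\<And>u y. u \<in> \<U> \<Longrightarrow> y \<in> H u \<Longrightarrow>
      0 \<le> (LINT t|lebesgue_on {0..}. supply_rate M (u t) (y t))"
  shows "scaled_graph \<U> H \<subseteq> multiplier_set M"
proof
  fix z assume "z \<in> scaled_graph \<U> H"
  then obtain u y where uy: "u \<in> \<U>" "\<not> L2_zero u" "y \<in> H u"
    and z: "z = rcis (sg_gain u y) (sg_phase u y) \<or> z = rcis (sg_gain u y) (- sg_phase u y)"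
    by (auto simp: scaled_graph_def)
  have L2: "u \<in> L2" "y \<in> L2"
    using uy \<U> H by auto
  note [simp] = integrable_inner_L2[OF L2(1) L2(1)] integrable_inner_L2[OF L2] integrable_inner_L2[OF L2(2) L2(2)]
  have nu: "L2_norm u > 0"
    using L2_norm_eq_0_iff[OF L2(1)] uy(2) by (simp add: L2_norm_def L2_inner_def less_le)
  have "norm z = sg_gain u y"
    using z nu by (auto simp: sg_gain_def L2_norm_def L2_inner_def)
  then have norm: "(norm z)\<^sup>2 = L2_inner y y / (L2_norm u)\<^sup>2"
    by (simp add: sg_gain_def power_divide L2_norm_power2)
  \<comment> \<open>The cosine is even, so both signs of the phase give the same real part.\<close>
  have "Re z = sg_gain u y * cos (sg_phase u y)"
    using z by (auto simp: rcis_def)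
  also have "\<dots> = L2_inner u y / (L2_norm u)\<^sup>2"
  proof (cases "L2_zero y")
    \<comment> \<open>The phase is 0 by convention here, but the gain is 0 as well, so both sides
      vanish.\<close>
    case True
    then show ?thesis
      using L2_norm_eq_0_iff[OF L2(2)] by (simp add: sg_gain_def L2_zero_inner)
  next
    case False
    then have ny: "L2_norm y > 0"
      using L2_norm_eq_0_iff[OF L2(2)] by (simp add: L2_norm_def L2_inner_def less_le)
    then have "\<bar>L2_inner u y / (L2_norm u * L2_norm y)\<bar> \<le> 1"
      using L2_Cauchy_Schwarz[OF L2] nu by (simp add: abs_mult)
    then have "cos (sg_phase u y) = L2_inner u y / (L2_norm u * L2_norm y)"
      using False by (simp add: sg_phase_def cos_arccos_abs)
    then show ?thesis
      using ny by (simp add: sg_gain_def power2_eq_square)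
  qed
  finally have re: "Re z = L2_inner u y / (L2_norm u)\<^sup>2" .
  have "M $ 1 $ 1 * (norm z)\<^sup>2 + 2 * (M $ 1 $ 2 * Re z) + M $ 2 $ 2
      = (M $ 1 $ 1 * L2_inner y y + 2 * (M $ 1 $ 2 * L2_inner u y) + M $ 2 $ 2 * L2_inner u u) / (L2_norm u)\<^sup>2"
    unfolding norm re L2_norm_power2[of u, symmetric] using nu by (simp add: field_simps)
  also have "\<dots> = (LINT t|lebesgue_on {0..}. supply_rate M (u t) (y t)) / (L2_norm u)\<^sup>2"
    by (simp add: supply_rate_def L2_inner_def)
  also have "\<dots> \<ge> 0"
    using dissipative uy by simp
  finally show "z \<in> multiplier_set M"
    by (simp add: multiplier_set_iff[OF M])
qed

subsection \<open>Dissipation\<close>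

text \<open>Set integrals can be cut down to \<open>{0..T}\<close> and compared with gauge
  integrals.\<close>

lemma set_integrable_of_lebesgue_on:
  fixes f :: "real \<Rightarrow> real"
  assumes "integrable (lebesgue_on {0..}) f"
  shows "set_integrable lebesgue {0..} f"
    and "integral\<^sup>L (lebesgue_on {0..}) f = set_lebesgue_integral lebesgue {0..} f"
  using assms
  by (simp_all add: set_integrable_def set_lebesgue_integral_def integrable_restrict_space
      integral_restrict_space)

text \<open>Integration of a derivative is stated with one fixed exceptional set instead of an
  almost-everywhere condition.\<close>

lemma negligible_AE_lebesgue_on:
  assumes "AE t in lebesgue_on {0..}. Q (t::real)"
  obtains S where "negligible S" "\<And>t. 0 \<le> t \<Longrightarrow> t \<notin> S \<Longrightarrow> Q t"
proof -
  have "AE t in lebesgue. t \<in> {0..} \<longrightarrow> Q t"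
    using assms by (simp add: AE_restrict_space_iff)
  then show thesis
    using that unfolding eventually_ae_filter
    by (auto simp: negligible_iff_null_sets)
qed

text \<open>A symmetric form factors like a difference of squares. On a compact interval
  \<open>x\<close> is bounded, hence so is the factor containing the sum, and the form is Lipschitz
  in \<open>x\<close>.\<close>

lemma abs_continuous_on_quadratic_form:
  fixes P :: "real ^ 'm ^ 'm"
  assumes P: "symmetric_mat P" and x: "abs_continuous_on a b x"
  shows "abs_continuous_on a b (\<lambda>t. x t \<bullet> (P *v x t))"
proof -
  have "bounded (x ` {a..b})"
    by (intro compact_imp_bounded compact_continuous_image abs_continuous_on_imp_continuous_on x)
       simp
  then obtain K where K: "\<And>t. t \<in> {a..b} \<Longrightarrow> norm (x t) \<le> K"
    unfolding bounded_iff by blast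
  obtain B where B: "B > 0" "\<And>v. norm (P *v v) \<le> norm v * B"
    using bounded_linear.pos_bounded[OF matrix_vector_mul_bounded_linear[of P]] by metis
  show ?thesis
  proof (rule abs_continuous_on_lipschitz_image[OF x])
    fix r s assume rs: "r \<in> {a..b}" "s \<in> {a..b}"
    have "x s \<bullet> (P *v x s) - x r \<bullet> (P *v x r) = (x s - x r) \<bullet> (P *v (x s + x r))"
      using symmetric_mat_inner[OF P, of "x s" "x r"]
      by (simp add: inner_diff_left inner_add_right matrix_vector_right_distrib)
    also have "norm \<dots> \<le> norm (x s - x r) * norm (P *v (x s + x r))"
      by (simp add: Cauchy_Schwarz_ineq2)
    also have "\<dots> \<le> norm (x s - x r) * (norm (x s + x r) * B)"
      by (intro mult_left_mono B) simp
    also have "\<dots> \<le> norm (x s - x r) * ((K + K) * B)"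
      using K[OF rs(1)] K[OF rs(2)] norm_triangle_ineq[of "x s" "x r"] B(1)
      by (intro mult_left_mono mult_right_mono) auto
    finally show "norm (x s \<bullet> (P *v x s) - x r \<bullet> (P *v x r)) \<le> (K + K) * B * norm (x s - x r)"
      by (simp add: mult_ac)
  qed
qed

text \<open>Absolute continuity permits the passage from the pointwise to the integrated bound: it
  makes the increment of the storage function the integral of a derivative known only off a null
  set.\<close>

lemma storage_function_le_supplied:
  fixes P :: "real ^ 'm ^ 'm"
  assumes P: "symmetric_mat P" and T: "0 \<le> T" and x: "abs_continuous_on 0 T x" "x 0 = 0"
    and \<sigma>: "\<sigma> integrable_on {0..T}" and S: "negligible S"
    and D: "\<And>t. t \<in> {0..T} - S \<Longrightarrow> (x has_vector_derivative D t) (at t within {0..T})"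
      "\<And>t. t \<in> {0..T} - S \<Longrightarrow> 2 * (D t \<bullet> (P *v x t)) \<le> \<sigma> t"
  shows "x T \<bullet> (P *v x T) \<le> integral {0..T} \<sigma>"
proof -
  define V where "V t = x t \<bullet> (P *v x t)" for t
  define V' where "V' t = 2 * (D t \<bullet> (P *v x t))" for t
  have "(V has_vector_derivative V' t) (at t within {0..T})" if "t \<in> {0..T} - S" for t
  proof -
    note Dt = D(1)[OF that]
    have "(V has_vector_derivative (x t \<bullet> (P *v D t) + D t \<bullet> (P *v x t))) (at t within {0..T})"
      unfolding V_def
      by (intro bounded_bilinear.has_vector_derivative[OF bounded_bilinear_inner] Dt
          bounded_linear.has_vector_derivative[OF matrix_vector_mul_bounded_linear Dt])
    then show ?thesis
      using symmetric_mat_inner[OF P, of "x t" "D t"] by (simp add: V'_def)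
  qed
  then have "(V' has_integral V T - V 0) {0..T}"
    using abs_continuous_on_quadratic_form[OF P x(1)] unfolding V_def[abs_def, symmetric]
    by (intro abs_continuous_on_has_integral[OF T _ S])
  \<comment> \<open>Nothing is known about \<open>V'\<close> on \<open>S\<close>; inserting
    \<open>\<sigma>\<close> there makes the comparison hold at every point.\<close>
  then have "((\<lambda>t. if t \<in> S then \<sigma> t else V' t) has_integral V T - V 0) {0..T}"
    by (rule has_integral_spike[OF S, rotated]) auto
  then have "V T - V 0 \<le> integral {0..T} \<sigma>"
    using D(2) by (intro has_integral_le[OF _ integrable_integral[OF \<sigma>]]) (auto simp: V'_def)
  then show ?thesis
    using x(2) by (simp add: V_def)
qed

text \<open>The state comes arbitrarily close to zero at late times, which is all that the energy
  argument asks of the final state; no limit at infinity is claimed.\<close>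

lemma L2_not_bounded_below:
  assumes x: "x \<in> L2" and c: "c > 0" and ge: "\<And>t. t \<ge> T0 \<Longrightarrow> c \<le> (norm (x t))\<^sup>2"
  shows False
proof -
  define R where "R = max 0 T0"
  define I where "I = integral {0..} (\<lambda>t. (norm (x t))\<^sup>2)"
  have int: "(\<lambda>t. (norm (x t))\<^sup>2) integrable_on {0..}"
    using x by (auto simp: L2_def intro!: set_lebesgue_integral_eq_integral set_integrable_of_lebesgue_on)
  have I: "I \<ge> 0"
    unfolding I_def by (intro integral_nonneg int) auto
  \<comment> \<open>The constant \<open>c\<close> alone then contributes \<open>I + 1\<close> over
    \<open>{R..T}\<close>, more than the whole integral.\<close>
  define T where "T = R + (I + 1) / c"
  have T: "R \<le> T" using I c by (simp add: T_def)
  have sub: "{R..T} \<subseteq> {0..}" by (auto simp: R_def)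
  have intT: "(\<lambda>t. (norm (x t))\<^sup>2) integrable_on {R..T}"
    using integrable_on_subinterval[OF int, of R T] sub by simp
  have "I + 1 = integral {R..T} (\<lambda>_. c)"
    using T c by (simp add: T_def)
  also have "\<dots> \<le> integral {R..T} (\<lambda>t. (norm (x t))\<^sup>2)"
    using ge by (intro integral_le intT) (auto simp: R_def)
  also have "\<dots> \<le> I"
    unfolding I_def by (intro integral_subset_le sub intT int) auto
  finally show False by simp
qed

lemma supplied_energy_nonneg:
  fixes P :: "real ^ 'm ^ 'm"
  assumes P: "symmetric_mat P" and x: "x 0 = 0" "locally_abs_continuous x" "x \<in> L2"
    and \<sigma>: "integrable (lebesgue_on {0..}) \<sigma>"
    and dissipation: "AE t in lebesgue_on {0..}.
      \<exists>d. (x has_vector_derivative d) (at t within {0..}) \<and> 2 * (d \<bullet> (P *v x t)) \<le> \<sigma> t"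
  shows "0 \<le> (LINT t|lebesgue_on {0..}. \<sigma> t)"
proof (rule ccontr)
  define J where "J = (LINT t|lebesgue_on {0..}. \<sigma> t)"
  assume "\<not> 0 \<le> (LINT t|lebesgue_on {0..}. \<sigma> t)"
  then have J: "J < 0" by (simp add: J_def)
  obtain S where S: "negligible S" "\<And>t. 0 \<le> t \<Longrightarrow> t \<notin> S \<Longrightarrow>
      \<exists>d. (x has_vector_derivative d) (at t within {0..}) \<and> 2 * (d \<bullet> (P *v x t)) \<le> \<sigma> t"
    using negligible_AE_lebesgue_on[OF dissipation] by blast
  then obtain D where D: "\<And>t. 0 \<le> t \<Longrightarrow> t \<notin> S \<Longrightarrow> (x has_vector_derivative D t) (at t within {0..})"
      "\<And>t. 0 \<le> t \<Longrightarrow> t \<notin> S \<Longrightarrow> 2 * (D t \<bullet> (P *v x t)) \<le> \<sigma> t"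
    by metis
  note set\<sigma> = set_integrable_of_lebesgue_on[OF \<sigma>]
  have V_le: "x T \<bullet> (P *v x T) \<le> set_lebesgue_integral lebesgue {0..T} \<sigma>" if T: "0 \<le> T" for T
  proof -
    have "set_integrable lebesgue {0..T} \<sigma>"
      using set\<sigma>(1) by (rule set_integrable_subset) auto
    note int = set_lebesgue_integral_eq_integral[OF this]
    have "x T \<bullet> (P *v x T) \<le> integral {0..T} \<sigma>"
    proof (rule storage_function_le_supplied[where x = x and D = D, OF P T _ x(1) int(1) S(1)])
      show "abs_continuous_on 0 T x"
        using x(2) T by (simp add: locally_abs_continuous_def)
      fix t assume t: "t \<in> {0..T} - S"
      then show "(x has_vector_derivative D t) (at t within {0..T})"
        by (intro has_vector_derivative_within_subset[OF D(1)]) auto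
      show "2 * (D t \<bullet> (P *v x t)) \<le> \<sigma> t"
        using t D(2) by auto
    qed
    then show ?thesis
      by (simp add: int(2))
  qed
  have "((\<lambda>T. set_lebesgue_integral lebesgue {0..T} \<sigma>) \<longlongrightarrow> J) at_top"
    unfolding J_def set\<sigma>(2) by (intro tendsto_set_lebesgue_integral_at_top set\<sigma>(1)) auto
  \<comment> \<open>Any fixed negative level above the limit \<open>J\<close> would do;
    \<open>J / 2\<close> is one.\<close>
  then have "\<forall>\<^sub>F T in at_top. set_lebesgue_integral lebesgue {0..T} \<sigma> < J / 2"
    using J by (intro order_tendstoD) auto
  then obtain T0 where T0: "\<And>T. T0 \<le> T \<Longrightarrow> set_lebesgue_integral lebesgue {0..T} \<sigma> < J / 2"
    by (auto simp: eventually_at_top_linorder)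
  obtain B where B: "B > 0" "\<And>v. norm (P *v v) \<le> norm v * B"
    using bounded_linear.pos_bounded[OF matrix_vector_mul_bounded_linear[of P]] by metis
  \<comment> \<open>The storage function lies below \<open>J / 2\<close>, while its absolute value
    is at most \<open>B\<close> times the squared norm of the state.\<close>
  have "- J / (2 * B) \<le> (norm (x T))\<^sup>2" if "max 0 T0 \<le> T" for T
  proof -
    have "- J / 2 \<le> \<bar>x T \<bullet> (P *v x T)\<bar>"
      using V_le[of T] T0[of T] that by simp
    also have "\<dots> \<le> norm (x T) * norm (P *v x T)"
      by (rule Cauchy_Schwarz_ineq2)
    also have "\<dots> \<le> norm (x T) * (norm (x T) * B)"
      by (intro mult_left_mono B) simp
    finally show ?thesis
      using B(1) by (simp add: field_simps power2_eq_square)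
  qed
  then show False
    using B(1) J by (intro L2_not_bounded_below[OF x(3), of "- J / (2 * B)" "max 0 T0"]) (auto simp: divide_neg_pos)
qed

lemma integrable_supply_rate:
  assumes "u \<in> L2" "y \<in> L2"
  shows "integrable (lebesgue_on {0..}) (\<lambda>t. supply_rate M (u t) (y t))"
  unfolding supply_rate_def using assms
  by (intro Bochner_Integration.integrable_add integrable_mult_right integrable_inner_L2)

theorem theorem16:
  fixes N :: nat
    and A :: "nat \<Rightarrow> real ^ 'm ^ 'm" and B :: "nat \<Rightarrow> real ^ 'n ^ 'm"
    and C :: "nat \<Rightarrow> real ^ 'm ^ 'n" and D :: "nat \<Rightarrow> real ^ 'n ^ 'n"
    and E :: "nat \<Rightarrow> real ^ ('m + 'n) ^ 'p"
    and \<U> :: "(real \<Rightarrow> real ^ 'n) set"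
    and M :: "real ^ 2 ^ 2"
    and U :: "nat \<Rightarrow> real ^ 'p ^ 'p"
    and P :: "real ^ 'm ^ 'm"
  assumes inputs: "\<U> \<subseteq> L2"
    and cover: "(\<Union>i\<in>{1..N}. cell (E i)) = UNIV"
    and existence: "\<And>u. u \<in> \<U> \<Longrightarrow> \<exists>x y. pwl_trajectory N A B C D E u x y"
    and regularity: "\<And>u x y. u \<in> \<U> \<Longrightarrow> pwl_trajectory N A B C D E u x y \<Longrightarrow>
          x \<in> L2 \<and> y \<in> L2 \<and> (\<lambda>t. vector_derivative x (at t within {0..})) \<in> L2"
    and zero: "pwl_output N A B C D E (\<lambda>_. 0) = {y. L2_zero y}"
    and M: "symmetric_mat M"
    and U: "\<And>i. i \<in> {1..N} \<Longrightarrow> symmetric_nonneg_mat (U i)"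
    and P: "symmetric_mat P"
    and lmi: "\<And>i. i \<in> {1..N} \<Longrightarrow>
          neg_semidef
            (transpose (block_mat (A i) (B i) (mat 1) 0) ** block_mat 0 P P 0 **
               block_mat (A i) (B i) (mat 1) 0
             - Theta (C i) (D i) M + transpose (E i) ** U i ** E i)"
  shows "scaled_graph \<U> (pwl_output N A B C D E) \<subseteq> multiplier_set M"
proof (rule scaled_graph_subset_multiplier_set[OF M inputs])
  show "pwl_output N A B C D E u \<subseteq> L2" for u
    by (auto simp: pwl_output_def)
  fix u y assume u: "u \<in> \<U>" and "y \<in> pwl_output N A B C D E u"
  then obtain x where y: "y \<in> L2" and traj: "pwl_trajectory N A B C D E u x y"
    by (auto simp: pwl_output_def)
  \<comment> \<open>All modes obey the same bound with one common \<open>P\<close>, so the active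
    mode, which may change with \<open>t\<close>, disappears from the statement.\<close>
  have "AE t in lebesgue_on {0..}. \<exists>d. (x has_vector_derivative d) (at t within {0..}) \<and>
      2 * (d \<bullet> (P *v x t)) \<le> supply_rate M (u t) (y t)"
    using traj unfolding pwl_trajectory_def
    by (auto elim!: eventually_mono) (metis U lmi lmi_imp_dissipation[OF M P] atLeastAtMost_iff One_nat_def)
  with traj regularity[OF u traj] y u inputs
  show "0 \<le> (LINT t|lebesgue_on {0..}. supply_rate M (u t) (y t))"
    by (intro supplied_energy_nonneg[OF P, of x] integrable_supply_rate)
       (auto simp: pwl_trajectory_def)
qed

end
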